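(* Let $d\geq 1$ and let $D$ be an oriented graph with no directed triangle, of minimum semi-degree $d$ and of order $n=md$ with $m\leq 5$. Then the diameter of $D$ is at most $9$.
   Context: Digraphs have no loops and no parallel arcs. An oriented graph is a digraph in which for any two distinct vertices $x,y$ at most one of $(x,y),(y,x)$ is an arc. The minimum semi-degree of $D$ is the minimum of its minimum out-degree and its minimum in-degree. A directed triangle is a directed cycle of length $3$. The distance $d(x,y)$ is the length of a shortest directed path from $x$ to $y$, and the diameter is the maximum of $d(x,y)$ over all ordered pairs of vertices. *)

theory Defs
  imports "Graph_Theory.Graph_Theory" "HOL-Library.Extended_Nat"
begin

locale oriented_graph = digraph +
  assumes no_opposite_arcs:
    "\<lbrakk>x \<in> verts G; y \<in> verts G; x \<noteq> y\<rbrakk> \<Longrightarrow> \<not> (x \<rightarrow>\<^bsub>G\<^esub> y \<and> y \<rightarrow>\<^bsub>G\<^esub> x)"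

definition directed_triangle :: "('a, 'b) pre_digraph \<Rightarrow> 'b awalk \<Rightarrow> bool" where
  "directed_triangle G p \<longleftrightarrow> pre_digraph.cycle G p \<and> length p = 3"

definition min_out_degree :: "('a, 'b) pre_digraph \<Rightarrow> nat" where
  "min_out_degree G = Min (out_degree G ` verts G)"

definition min_in_degree :: "('a, 'b) pre_digraph \<Rightarrow> nat" where
  "min_in_degree G = Min (in_degree G ` verts G)"

definition min_semi_degree :: "('a, 'b) pre_digraph \<Rightarrow> nat" where
  "min_semi_degree G = min (min_out_degree G) (min_in_degree G)"

text \<open>The infimum of the empty set is \<open>\<infinity>\<close>, so the distance is infinite when there is no
  directed path, and a finite diameter entails strong connectivity.\<close>

definition digraph_dist :: "('a, 'b) pre_digraph \<Rightarrow> 'a \<Rightarrow> 'a \<Rightarrow> enat" where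
  "digraph_dist G x y = (INF p \<in> {p. pre_digraph.apath G x p y}. enat (length p))"

definition digraph_diameter :: "('a, 'b) pre_digraph \<Rightarrow> enat" where
  "digraph_diameter G = (SUP x \<in> verts G. SUP y \<in> verts G. digraph_dist G x y)"

end

theory Submission
  imports Defs
begin

text \<open>
  Suppose every nonempty set \<open>S\<close> has a vertex dominating at most \<open>c |S|\<close> of its members.
  For \<open>v \<in> S\<close> apply this to \<open>N\<^sup>+(v) \<inter> S\<close> and get \<open>u\<close>; since there is no directed
  triangle, \<open>N\<^sup>+(u)\<close> misses \<open>N\<^sup>-(v)\<close>, so \<open>N\<^sup>-(v)\<close>, \<open>N\<^sup>+(v)\<close> and most of \<open>N\<^sup>+(u)\<close> are
  disjoint parts of \<open>S\<close>. Summing over \<open>v\<close> bounds \<open>(2 - c) e(S) + \<delta> |S|\<close> by \<open>|S|\<^sup>2\<close>, where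
  \<open>\<delta>\<close> is the minimum out-degree inside \<open>S\<close> and \<open>e(S)\<close> its number of arcs. The trivial
  value \<open>c = 1/2\<close> thereby improves to \<open>c = 2/5\<close>.

  Applied with \<open>c = 2/5\<close> to the out-ball of radius \<open>r\<close> around a vertex, in which the vertices
  of the ball of radius \<open>r - 1\<close> have full out-degree, the inequality forces the balls of radius
  \<open>4\<close> and \<open>5\<close> to have at least \<open>2.47 d\<close> and \<open>2.55 d\<close> vertices. By symmetry this holds for
  in-balls too, and as \<open>2.47 + 2.55 > 5\<close> the out-ball of radius \<open>4\<close> around \<open>x\<close> meets the
  in-ball of radius \<open>5\<close> around \<open>y\<close>.
\<close>

section \<open>Arc counts inside finite sets\<close>

locale triangle_free_relation =
  fixes E :: "'a \<Rightarrow> 'a \<Rightarrow> bool"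
  assumes asym: "E a b \<Longrightarrow> \<not> E b a"
    and no_triangle: "E a b \<Longrightarrow> E b c \<Longrightarrow> \<not> E c a"
begin

definition outs :: "'a set \<Rightarrow> 'a \<Rightarrow> 'a set" where
  "outs S v = {w \<in> S. E v w}"

definition ins :: "'a set \<Rightarrow> 'a \<Rightarrow> 'a set" where
  "ins S v = {w \<in> S. E w v}"

text \<open>The bound is demanded of all nonempty finite sets at once, so that it can be used inside
  an out-neighbourhood.\<close>

definition sparse :: "real \<Rightarrow> bool" where
  "sparse c \<longleftrightarrow>
    (\<forall>S. finite S \<longrightarrow> S \<noteq> {} \<longrightarrow> (\<exists>u\<in>S. real (card (outs S u)) \<le> c * real (card S)))"

lemma finite_outs [simp]: "finite S \<Longrightarrow> finite (outs S v)"
  and finite_ins [simp]: "finite S \<Longrightarrow> finite (ins S v)"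
  by (simp_all add: outs_def ins_def)

lemma sum_card_ins:
  assumes "finite S"
  shows "(\<Sum>v\<in>S. card (ins S v)) = (\<Sum>v\<in>S. card (outs S v))"
proof -
  have "(\<Sum>v\<in>S. card (ins S v)) = (\<Sum>v\<in>S. \<Sum>w\<in>S. if E w v then 1 else 0)"
    using assms by (simp add: ins_def sum.If_cases Int_def)
  also have "\<dots> = (\<Sum>w\<in>S. \<Sum>v\<in>S. if E w v then 1 else 0)"
    by (rule sum.swap)
  also have "\<dots> = (\<Sum>v\<in>S. card (outs S v))"
    using assms by (simp add: outs_def sum.If_cases Int_def)
  finally show ?thesis .
qed

text \<open>By asymmetry out-degree and in-degree add up to at most \<open>card S\<close> at each
  vertex; both have the same sum over \<open>S\<close>, so the average out-degree is at most half of
  \<open>card S\<close>.\<close>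

lemma sparse_half: "sparse (1/2)"
  unfolding sparse_def
proof (intro allI impI)
  fix S :: "'a set"
  assume S: "finite S" "S \<noteq> {}"
  have le: "card (outs S v) + card (ins S v) \<le> card S" for v
  proof -
    have "outs S v \<inter> ins S v = {}"
      using asym by (auto simp: outs_def ins_def)
    then have "card (outs S v) + card (ins S v) = card (outs S v \<union> ins S v)"
      using S by (simp add: card_Un_disjoint)
    also have "\<dots> \<le> card S"
      using S by (intro card_mono) (auto simp: outs_def ins_def)
    finally show ?thesis .
  qed
  show "\<exists>u\<in>S. real (card (outs S u)) \<le> 1/2 * real (card S)"
  proof (rule ccontr)
    assume "\<not> ?thesis"
    then have "card S < 2 * card (outs S v)" if "v \<in> S" for v
      using that by fastforce
    then have "(\<Sum>v\<in>S. card S) < (\<Sum>v\<in>S. 2 * card (outs S v))"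
      using S by (intro sum_strict_mono) auto
    also have "\<dots> = (\<Sum>v\<in>S. card (outs S v) + card (ins S v))"
      using sum_card_ins[OF S(1)] by (simp add: sum.distrib mult_2)
    also have "\<dots> \<le> (\<Sum>v\<in>S. card S)"
      by (intro sum_mono le)
    finally show False by simp
  qed
qed

lemma card_neighbourhoods_le:
  assumes "sparse c" "finite S" "v \<in> S"
    and deg: "\<And>u. u \<in> S \<Longrightarrow> \<delta> \<le> real (card (outs S u))"
  shows "real (card (ins S v)) + (1 - c) * real (card (outs S v)) + \<delta> \<le> real (card S)"
proof (cases "outs S v = {}")
  case True
  \<comment> \<open>\<open>sparse\<close> says nothing about the empty set, but an empty
    out-neighbourhood leaves no room for a positive \<delta>.\<close>
  have "\<delta> \<le> 0"
    using deg[OF \<open>v \<in> S\<close>] True by simp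
  moreover have "card (ins S v) \<le> card S"
    using \<open>finite S\<close> by (intro card_mono) (auto simp: ins_def)
  ultimately show ?thesis
    using True by simp
next
  case False
  let ?O = "outs S v"
  obtain u where u: "u \<in> ?O" "real (card (outs ?O u)) \<le> c * real (card ?O)"
    using assms(1) False \<open>finite S\<close> unfolding sparse_def by (meson finite_outs)
  have "\<delta> \<le> real (card (outs S u))"
    using deg u(1) by (simp add: outs_def)
  also have "card (outs S u) = card (outs ?O u \<union> (outs S u - ?O))"
    by (intro arg_cong[of _ _ card]) (auto simp: outs_def)
  also have "\<dots> = card (outs ?O u) + card (outs S u - ?O)"
    using \<open>finite S\<close> by (intro card_Un_disjoint) (auto simp: outs_def)
  finally have 1: "\<delta> \<le> real (card (outs ?O u)) + real (card (outs S u - ?O))"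
    by simp
  \<comment> \<open>A common vertex \<open>w\<close> of \<open>ins S v\<close> and
    \<open>outs S u\<close> would close the triangle \<open>v\<close>, \<open>u\<close>,
    \<open>w\<close>.\<close>
  have disj: "ins S v \<inter> ?O = {}" "(ins S v \<union> ?O) \<inter> (outs S u - ?O) = {}"
    using asym no_triangle u(1) unfolding outs_def ins_def by blast+
  have "card (ins S v) + card ?O + card (outs S u - ?O) = card (ins S v \<union> ?O \<union> (outs S u - ?O))"
    using \<open>finite S\<close> disj by (simp add: card_Un_disjoint)
  also have "\<dots> \<le> card S"
    using \<open>finite S\<close> by (intro card_mono) (auto simp: outs_def ins_def)
  finally have "real (card (ins S v)) + real (card ?O) + real (card (outs S u - ?O)) \<le> real (card S)"
    by linarith
  with 1 u(2) show ?thesis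
    by (simp add: algebra_simps)
qed

lemma arc_count_le:
  assumes "sparse c" "finite S"
    and "\<And>u. u \<in> S \<Longrightarrow> \<delta> \<le> real (card (outs S u))"
  shows "(2 - c) * (\<Sum>v\<in>S. real (card (outs S v))) + \<delta> * real (card S) \<le> (real (card S))\<^sup>2"
proof -
  have "(2 - c) * (\<Sum>v\<in>S. real (card (outs S v))) + \<delta> * real (card S)
      = (\<Sum>v\<in>S. real (card (ins S v))) + (1 - c) * (\<Sum>v\<in>S. real (card (outs S v)))
        + \<delta> * real (card S)"
    using arg_cong[OF sum_card_ins[OF \<open>finite S\<close>], of real] by (simp add: algebra_simps)
  also have "\<dots> = (\<Sum>v\<in>S. real (card (ins S v)) + (1 - c) * real (card (outs S v)) + \<delta>)"
    by (simp add: sum.distrib sum_distrib_left)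
  also have "\<dots> \<le> (\<Sum>v\<in>S. real (card S))"
    using assms by (intro sum_mono card_neighbourhoods_le) auto
  finally show ?thesis
    by (simp add: power2_eq_square)
qed

text \<open>The value 2/5 solves (2 - 1/2) x + x = 1: if all out-degrees exceeded 2/5 of
  \<open>card S\<close>, \<open>arc_count_le\<close> with \<open>c = 1/2\<close> would be
  violated.\<close>

lemma sparse_two_fifths: "sparse (2/5)"
  unfolding sparse_def
proof (intro allI impI, rule ccontr)
  fix S :: "'a set"
  assume S: "finite S" "S \<noteq> {}"
    and "\<not> (\<exists>u\<in>S. real (card (outs S u)) \<le> 2/5 * real (card S))"
  then have gt: "2/5 * real (card S) < real (card (outs S v))" if "v \<in> S" for v
    using that by fastforce
  have "(\<Sum>v\<in>S. 2/5 * real (card S)) < (\<Sum>v\<in>S. real (card (outs S v)))"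
    using S gt by (intro sum_strict_mono) auto
  moreover have "(2 - 1/2) * (\<Sum>v\<in>S. real (card (outs S v))) + 2/5 * real (card S) * real (card S)
      \<le> (real (card S))\<^sup>2"
    using S gt by (intro arc_count_le sparse_half) (auto intro: less_imp_le)
  ultimately show False
    by (simp add: power2_eq_square)
qed

text \<open>Inside \<open>B\<close>, vertices of \<open>A\<close> keep out-degree \<open>d\<close>,
  and the others lose at most the \<open>t\<close> vertices of \<open>C - B\<close>. Now
  \<open>arc_count_le\<close> applies with \<delta> \<open>= d - t\<close>, possibly negative; 8/5
  is 2 - 2/5, and 13/5 is 8/5 + 1.\<close>

lemma nested_growth:
  assumes "finite C" "A \<subseteq> B" "B \<subseteq> C"
    and degA: "\<And>v. v \<in> A \<Longrightarrow> d \<le> card (outs B v)"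
    and degB: "\<And>v. v \<in> B \<Longrightarrow> d \<le> card (outs C v)"
  shows "13/5 * real d * card B \<le>
    (real (card B))\<^sup>2 + (real (card C) - card B) * (card B + 8/5 * (real (card B) - card A))"
proof -
  have fin: "finite B" "finite A"
    using assms(1-3) by (meson finite_subset)+
  define t where "t = real (card C) - real (card B)"
  have low: "real d - t \<le> real (card (outs B v))" if "v \<in> B" for v
  proof -
    have "card (outs C v) \<le> card (outs B v \<union> (C - B))"
      using \<open>finite C\<close> fin by (intro card_mono) (auto simp: outs_def)
    also have "\<dots> \<le> card (outs B v) + card (C - B)"
      by (rule card_Un_le)
    also have "card (C - B) = card C - card B"
      using fin assms(1-3) by (intro card_Diff_subset)
    finally show ?thesis
      using degB[OF that] card_mono[OF \<open>finite C\<close> \<open>B \<subseteq> C\<close>] by (simp add: t_def)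
  qed
  have "real (card A) * d + (real (card B) - card A) * (d - t)
      = (\<Sum>v\<in>A. real d) + (\<Sum>v\<in>B - A. real d - t)"
    using fin assms(1-3) by (simp add: card_Diff_subset of_nat_diff card_mono)
  also have "\<dots> \<le> (\<Sum>v\<in>A. real (card (outs B v))) + (\<Sum>v\<in>B - A. real (card (outs B v)))"
    using degA low by (intro add_mono sum_mono) auto
  also have "\<dots> = (\<Sum>v\<in>B. real (card (outs B v)))"
    using fin \<open>A \<subseteq> B\<close> by (metis add.commute sum.subset_diff)
  finally have arcs: "real (card A) * d + (real (card B) - card A) * (d - t)
      \<le> (\<Sum>v\<in>B. real (card (outs B v)))" .
  have count: "(2 - 2/5) * (\<Sum>v\<in>B. real (card (outs B v))) + (real d - t) * card B
      \<le> (real (card B))\<^sup>2"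
    using fin low by (intro arc_count_le sparse_two_fifths) auto
  have "8/5 * X + Y \<le> Z" if "X \<le> e" "(2 - 2/5) * e + Y \<le> Z" for X Y Z e :: real
    using that by simp
  from this[OF arcs count] have "8/5 * (real (card A) * d + (real (card B) - card A) * (d - t))
      + (real d - t) * card B \<le> (real (card B))\<^sup>2" .
  then show ?thesis
    unfolding t_def[symmetric] by (simp add: field_simps)
qed

end

text \<open>The hypotheses \<open>pos\<close> and \<open>deriv\<close> say \<open>F(Q) > 0\<close> and \<open>F'(Q) \<ge> 0\<close> for the convex quadratic
  \<open>F(b)\<close> that is the left minus the right side of \<open>ineq\<close> at \<open>a = P\<close>, \<open>c = R\<close>, \<open>d = 1\<close>.\<close>

lemma growth_step:
  fixes a b c d P Q R :: real
  assumes ineq: "13/5 * d * b \<le> b\<^sup>2 + (c - b) * (b + 8/5 * (b - a))"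
    and "d > 0" "P * d \<le> a" "a \<le> b" "Q * d \<le> b" "b \<le> c"
    and pos: "8/5 * Q\<^sup>2 + (13/5 - 8/5 * P - 13/5 * R) * Q + 8/5 * R * P > 0"
    and deriv: "16/5 * Q + 13/5 - 8/5 * P - 13/5 * R \<ge> 0"
    and "0 < Q"
  shows "R * d \<le> c"
proof (rule ccontr)
  assume "\<not> ?thesis"
  then have c: "c < R * d" by simp
  have "b > 0"
    using assms by (smt (verit) mult_pos_pos)
  have "(c - b) * (b + 8/5 * (b - a)) \<le> (R * d - b) * (b + 8/5 * (b - a))"
    using c \<open>a \<le> b\<close> \<open>b > 0\<close> by (intro mult_right_mono) auto
  with ineq have 1: "8/5 * b\<^sup>2 + 13/5 * d * b - 8/5 * a * b - 13/5 * R * d * b + 8/5 * R * d * a \<le> 0"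
    by (simp add: field_simps power2_eq_square)
  \<comment> \<open>The quadratic increases with \<open>a\<close> because \<open>b < R * d\<close>,
    so \<open>a\<close> may be lowered to \<open>P * d\<close>. The next three facts are the terms
    of its Taylor expansion in \<open>b\<close> at \<open>Q * d\<close>.\<close>
  have "0 \<le> (a - P * d) * (R * d - b)"
    using assms c by (intro mult_nonneg_nonneg) auto
  moreover have "0 \<le> (b - Q * d) * ((16/5 * Q + 13/5 - 8/5 * P - 13/5 * R) * d)"
    using assms by (intro mult_nonneg_nonneg) auto
  moreover have "0 \<le> (b - Q * d)\<^sup>2" by simp
  moreover have "0 < (8/5 * Q\<^sup>2 + (13/5 - 8/5 * P - 13/5 * R) * Q + 8/5 * R * P) * d\<^sup>2"
    using pos \<open>d > 0\<close> by simp
  ultimately have "0 < 8/5 * b\<^sup>2 + 13/5 * d * b - 8/5 * a * b - 13/5 * R * d * b + 8/5 * R * d * a"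
    by (simp add: field_simps power2_eq_square)
  with 1 show False by simp
qed

section \<open>Balls and their growth\<close>

definition rel_ball :: "('a \<Rightarrow> 'a \<Rightarrow> bool) \<Rightarrow> 'a \<Rightarrow> nat \<Rightarrow> 'a set" where
  "rel_ball E x r = {w. \<exists>k\<le>r. (E ^^ k) x w}"

lemma rel_ball_mono: "r \<le> s \<Longrightarrow> rel_ball E x r \<subseteq> rel_ball E x s"
  by (auto simp: rel_ball_def intro: le_trans)

lemma rel_ball_0 [simp]: "rel_ball E x 0 = {x}"
  by (auto simp: rel_ball_def)

lemma rel_ball_step: "v \<in> rel_ball E x r \<Longrightarrow> E v w \<Longrightarrow> w \<in> rel_ball E x (Suc r)"
  unfolding rel_ball_def by (blast intro: relpowp_Suc_I Suc_le_mono[THEN iffD2])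

lemma rel_ball_subset:
  assumes "x \<in> V" "\<And>v w. E v w \<Longrightarrow> w \<in> V"
  shows "rel_ball E x r \<subseteq> V"
proof
  fix w assume "w \<in> rel_ball E x r"
  then obtain k where "(E ^^ k) x w"
    by (auto simp: rel_ball_def)
  then show "w \<in> V"
    using assms by (cases k) auto
qed

lemma relpowp_converse:
  fixes E :: "'a \<Rightarrow> 'a \<Rightarrow> bool"
  shows "((\<lambda>a b. E b a) ^^ k) x y \<longleftrightarrow> (E ^^ k) y x"
proof (induction k arbitrary: y)
  case (Suc k)
  have "((\<lambda>a b. E b a) ^^ Suc k) x y \<longleftrightarrow> (\<exists>z. E y z \<and> (E ^^ k) z x)"
    using Suc.IH by (auto simp: relcompp_apply)
  also have "\<dots> \<longleftrightarrow> (E ^^ Suc k) y x"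
    by (meson relpowp_Suc_D2 relpowp_Suc_I2)
  finally show ?case .
qed auto

lemma rel_balls_meet:
  assumes "z \<in> rel_ball E x r" "z \<in> rel_ball (\<lambda>a b. E b a) y s"
  obtains k where "k \<le> r + s" "(E ^^ k) x y"
proof -
  obtain i j where "i \<le> r" "(E ^^ i) x z" "j \<le> s" "((\<lambda>a b. E b a) ^^ j) y z"
    using assms by (auto simp: rel_ball_def)
  moreover from this have "(E ^^ j) z y"
    using relpowp_converse[of j E y z] by blast
  ultimately have "i + j \<le> r + s" "(E ^^ (i + j)) x y"
    by (auto simp: relpowp_add)
  then show thesis by (rule that)
qed

text \<open>Three consecutive balls serve as \<open>A\<close>, \<open>B\<close>, \<open>C\<close> in
  \<open>nested_growth\<close>, so lower bounds for two radii yield one for the next.\<close>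

lemma (in triangle_free_relation) rel_ball_card_bounds:
  assumes V: "finite V" "x \<in> V" "\<And>v w. E v w \<Longrightarrow> w \<in> V"
    and deg: "\<And>v. v \<in> V \<Longrightarrow> d \<le> card {w. E v w}"
    and "d > 0"
  shows "247/100 * real d \<le> card (rel_ball E x 4)"
    and "51/20 * real d \<le> card (rel_ball E x 5)"
proof -
  let ?B = "rel_ball E x"
  let ?b = "\<lambda>r. real (card (?B r))"
  have sub: "?B r \<subseteq> V" for r
    using V by (intro rel_ball_subset) auto
  then have fin: "finite (?B r)" for r
    using V(1) finite_subset by blast
  have full: "d \<le> card (outs (?B (Suc r)) v)" if "v \<in> ?B r" for r v
  proof -
    have "outs (?B (Suc r)) v = {w. E v w}"
      using rel_ball_step[OF that] by (auto simp: outs_def)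
    then show ?thesis
      using deg that sub by auto
  qed
  have mono: "?b r \<le> ?b (Suc r)" for r
    using fin by (simp add: card_mono rel_ball_mono)
  have growth: "R * real d \<le> ?b (Suc (Suc r))"
    if "P * d \<le> ?b r" "Q * d \<le> ?b (Suc r)" "0 < Q"
      "8/5 * Q\<^sup>2 + (13/5 - 8/5 * P - 13/5 * R) * Q + 8/5 * R * P > 0"
      "16/5 * Q + 13/5 - 8/5 * P - 13/5 * R \<ge> 0" for r and P Q R :: real
  proof (rule growth_step)
    show "13/5 * real d * ?b (Suc r) \<le> (?b (Suc r))\<^sup>2
        + (?b (Suc (Suc r)) - ?b (Suc r)) * (?b (Suc r) + 8/5 * (?b (Suc r) - ?b r))"
      using fin full by (intro nested_growth rel_ball_mono) auto
  qed (use that mono \<open>d > 0\<close> in auto)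
  have "d \<le> card (outs (?B 1) x)"
    using full[of x 0] by simp
  also have "\<dots> \<le> card (?B 1)"
    using fin by (intro card_mono) (auto simp: outs_def)
  finally have b1: "1 * real d \<le> ?b (Suc 0)"
    by simp
  \<comment> \<open>Radius 0 contributes only the trivial bound \<open>P = 0\<close>. Here and
    below, \<open>R\<close> is rounded down from the value at which the positivity condition of
    \<open>growth_step\<close> fails for the given \<open>P\<close> and \<open>Q\<close>.\<close>
  have b2: "8/5 * real d \<le> ?b (Suc (Suc 0))"
    by (rule growth[of 0 _ 1]) (use b1 in \<open>auto simp: power2_eq_square\<close>)
  have b3: "11/5 * real d \<le> ?b (Suc (Suc (Suc 0)))"
    by (rule growth[of 1 _ "8/5"]) (use b1 b2 in \<open>auto simp: power2_eq_square\<close>)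
  have b4: "247/100 * real d \<le> ?b (Suc (Suc (Suc (Suc 0))))"
    by (rule growth[of "8/5" _ "11/5"]) (use b2 b3 in \<open>auto simp: power2_eq_square\<close>)
  have b5: "51/20 * real d \<le> ?b (Suc (Suc (Suc (Suc (Suc 0)))))"
    by (rule growth[of "11/5" _ "247/100"]) (use b3 b4 in \<open>auto simp: power2_eq_square\<close>)
  show "247/100 * real d \<le> ?b 4" "51/20 * real d \<le> ?b 5"
    using b4 b5 by (simp_all add: numeral_eq_Suc)
qed

text \<open>In-balls are balls of the converse relation, so the growth bounds cover them
  too.\<close>

lemma (in triangle_free_relation) triangle_free_relation_converse:
  "triangle_free_relation (\<lambda>a b. E b a)"
  by unfold_locales (blast dest: asym, blast dest: no_triangle)

lemma (in triangle_free_relation) relpowp_le_9: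
  assumes V: "finite V" "\<And>v w. E v w \<Longrightarrow> v \<in> V \<and> w \<in> V" "x \<in> V" "y \<in> V"
    and out: "\<And>v. v \<in> V \<Longrightarrow> d \<le> card {w. E v w}"
    and inn: "\<And>v. v \<in> V \<Longrightarrow> d \<le> card {w. E w v}"
    and d: "d > 0" and card: "card V \<le> 5 * d"
  obtains k where "k \<le> 9" "(E ^^ k) x y"
proof -
  interpret conv: triangle_free_relation "\<lambda>a b. E b a"
    by (rule triangle_free_relation_converse)
  let ?X = "rel_ball E x 4" and ?Y = "rel_ball (\<lambda>a b. E b a) y 5"
  have "247/100 * real d \<le> card ?X"
    using V out d by (intro rel_ball_card_bounds) auto
  moreover have "51/20 * real d \<le> card ?Y"
    using V inn d by (intro conv.rel_ball_card_bounds) auto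
  ultimately have "real (card V) < real (card ?X) + real (card ?Y)"
    using card d by linarith
  moreover have sub: "?X \<subseteq> V" "?Y \<subseteq> V"
    using V by (intro rel_ball_subset; auto)+
  then have "card ?X + card ?Y \<le> card V" if "?X \<inter> ?Y = {}"
    using that V(1) by (metis Un_least card_Un_disjoint card_mono finite_subset)
  ultimately have "?X \<inter> ?Y \<noteq> {}"
    by linarith
  then obtain z where "z \<in> ?X" "z \<in> ?Y" by blast
  then show thesis
    by (rule rel_balls_meet) (rule that, auto)
qed

section \<open>Translation between relation and digraph\<close>

lemma (in wf_digraph) awalk_shortens_to_apath:
  assumes "awalk u p v"
  obtains q where "apath u q v" "length q \<le> length p"
proof -
  have "\<exists>q. apath u q v \<and> length q \<le> length p"
    using assms
  proof (induction p rule: length_induct)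
    case (1 p)
    show ?case
    proof (cases "distinct (awalk_verts u p)")
      case True
      then show ?thesis
        using 1 by (auto simp: apath_def)
    next
      case False
      \<comment> \<open>A repeated vertex bounds a closed subwalk \<open>r\<close>, which is cut
        out.\<close>
      then obtain q r s w where p: "p = q @ r @ s" "0 < length r" "awalk u q w" "awalk w s v"
        using awalk_not_distinct_decomp[OF \<open>awalk u p v\<close>] by blast
      then have "length (q @ s) < length p" "awalk u (q @ s) v"
        by (auto intro: awalk_appendI simp del: awalk_append_iff)
      then obtain q' where "apath u q' v" "length q' \<le> length (q @ s)"
        using 1 by blast
      with \<open>length (q @ s) < length p\<close> show ?thesis
        by (intro exI[of _ q']) simp
    qed
  qed
  then show thesis using that by blast
qed

lemma (in wf_digraph) relpowp_dominates_imp_awalk: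
  assumes "(dominates G ^^ k) u v" "v \<in> verts G"
  shows "\<exists>p. awalk u p v \<and> length p = k"
  using assms
proof (induction k arbitrary: u)
  case 0
  then show ?case
    by (auto simp: awalk_Nil_iff)
next
  case (Suc k)
  then obtain w where "u \<rightarrow>\<^bsub>G\<^esub> w" "(dominates G ^^ k) w v"
    by (meson relpowp_Suc_D2)
  moreover from this Suc obtain p where "awalk w p v" "length p = k" by blast
  moreover from \<open>u \<rightarrow>\<^bsub>G\<^esub> w\<close> obtain e where "e \<in> arcs G" "tail G e = u" "head G e = w"
    by (auto simp: arcs_ends_def arc_to_ends_def)
  ultimately show ?case
    by (intro exI[of _ "e # p"]) (auto simp: awalk_Cons_iff)
qed

text \<open>Degrees count arcs, the relational argument counts vertices; without parallel arcs the
  two agree.\<close>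

lemma (in nomulti_digraph) out_degree_eq_card: "out_degree G v = card {w. v \<rightarrow>\<^bsub>G\<^esub> w}"
proof -
  have "{w. v \<rightarrow>\<^bsub>G\<^esub> w} = head G ` out_arcs G v"
    by (auto simp: arcs_ends_def arc_to_ends_def out_arcs_def)
  moreover have "inj_on (head G) (out_arcs G v)"
    by (auto simp: inj_on_def out_arcs_def arc_to_ends_def intro: no_multi_arcs)
  ultimately show ?thesis
    by (simp add: out_degree_def card_image)
qed

lemma (in nomulti_digraph) in_degree_eq_card: "in_degree G v = card {w. w \<rightarrow>\<^bsub>G\<^esub> v}"
proof -
  have "{w. w \<rightarrow>\<^bsub>G\<^esub> v} = tail G ` in_arcs G v"
    by (auto simp: arcs_ends_def arc_to_ends_def in_arcs_def)
  moreover have "inj_on (tail G) (in_arcs G v)"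
    by (auto simp: inj_on_def in_arcs_def arc_to_ends_def intro: no_multi_arcs)
  ultimately show ?thesis
    by (simp add: in_degree_def card_image)
qed

lemma (in oriented_graph) triangle_free_relation_dominates:
  assumes "\<nexists>p. directed_triangle G p"
  shows "triangle_free_relation (dominates G)"
proof
  fix a b
  assume "a \<rightarrow>\<^bsub>G\<^esub> b"
  moreover from this have "a \<in> verts G" "b \<in> verts G" "a \<noteq> b"
    using no_loops by (auto simp: arcs_ends_def arc_to_ends_def)
  ultimately show "\<not> b \<rightarrow>\<^bsub>G\<^esub> a"
    using no_opposite_arcs by blast
next
  fix a b c
  assume ab: "a \<rightarrow>\<^bsub>G\<^esub> b" and bc: "b \<rightarrow>\<^bsub>G\<^esub> c"
  show "\<not> c \<rightarrow>\<^bsub>G\<^esub> a"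
  proof
    assume ca: "c \<rightarrow>\<^bsub>G\<^esub> a"
    obtain e f g where arcs: "e \<in> arcs G" "tail G e = a" "head G e = b"
      "f \<in> arcs G" "tail G f = b" "head G f = c" "g \<in> arcs G" "tail G g = c" "head G g = a"
      using ab bc ca by (auto simp: arcs_ends_def arc_to_ends_def)
    \<comment> \<open>Distinct vertices make the closed walk a \<open>cycle\<close>.\<close>
    then have "a \<noteq> b" "b \<noteq> c" "c \<noteq> a"
      using no_loops by metis+
    then have "cycle [e, f, g]"
      using arcs unfolding cycle_def
      by (intro exI[of _ a]) (auto simp: awalk_Cons_iff awalk_Nil_iff)
    then show False
      using assms by (auto simp: directed_triangle_def)
  qed
qed

theorem theorem1p7:
  fixes D :: "('a, 'b) pre_digraph" and d :: nat and m :: real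
  assumes "d \<ge> 1"
    and "oriented_graph D"
    and "\<nexists>p. directed_triangle D p"
    and "min_semi_degree D = d"
    and "real (card (verts D)) = m * real d"
    and "m \<le> 5"
  shows "digraph_diameter D \<le> 9"
proof -
  interpret oriented_graph D by fact
  interpret triangle_free_relation "dominates D"
    by (rule triangle_free_relation_dominates) fact
  have out: "d \<le> card {w. v \<rightarrow>\<^bsub>D\<^esub> w}" if "v \<in> verts D" for v
  proof -
    have "min_out_degree D \<le> out_degree D v"
      unfolding min_out_degree_def using that by (intro Min_le) auto
    then show ?thesis
      using assms(4) by (simp add: min_semi_degree_def out_degree_eq_card)
  qed
  have inn: "d \<le> card {w. w \<rightarrow>\<^bsub>D\<^esub> v}" if "v \<in> verts D" for v
  proof -
    have "min_in_degree D \<le> in_degree D v"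
      unfolding min_in_degree_def using that by (intro Min_le) auto
    then show ?thesis
      using assms(4) by (simp add: min_semi_degree_def in_degree_eq_card)
  qed
  have "real (card (verts D)) \<le> 5 * real d"
    using assms(5,6) by (simp add: mult_right_mono)
  then have card: "card (verts D) \<le> 5 * d"
    by linarith
  have "digraph_dist D x y \<le> 9" if xy: "x \<in> verts D" "y \<in> verts D" for x y
  proof -
    obtain k where "k \<le> 9" "(dominates D ^^ k) x y"
      by (rule relpowp_le_9[of "verts D" x y d])
        (use xy out inn card \<open>d \<ge> 1\<close> in \<open>auto simp: arcs_ends_def arc_to_ends_def\<close>)
    then obtain p where "awalk x p y" "length p \<le> 9"
      using relpowp_dominates_imp_awalk xy by blast
    \<comment> \<open>The distance ranges over \<open>apath\<close>s only, so the walk must first be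
      freed of repeated vertices.\<close>
    then obtain q where q: "apath x q y" "length q \<le> 9"
      by (meson awalk_shortens_to_apath le_trans)
    then have "digraph_dist D x y \<le> enat (length q)"
      unfolding digraph_dist_def by (intro INF_lower) simp
    also have "\<dots> \<le> 9"
      using q(2) by (simp add: numeral_eq_enat)
    finally show ?thesis .
  qed
  then show ?thesis
    unfolding digraph_diameter_def by (intro SUP_least)
qed

end
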